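(* There exists a (non-empty) Borel set $\Lambda\subset(0,1)$ which is invariant under the Gauss map $g$, i.e. $g(\Lambda)=\Lambda$, and whose box dimension does not exist, i.e. $\underline{\dim}_{\mathrm B}\Lambda<\overline{\dim}_{\mathrm B}\Lambda$.
   Context: The Gauss map is $g\colon(0,1]\to S^1$, $g(x)=1/x$ (mod $1$), where $S^1=\mathbb{R}/\mathbb{Z}$ is identified with $[0,1)$. A set $\Lambda$ is invariant under a map $f$ if $f(\Lambda)=\Lambda$. For a non-empty bounded set $E\subset\mathbb{R}^d$, $N_r(E)$ is the least number of open balls of radius $r$ required to cover $E$, and $\underline{\dim}_{\mathrm B}E=\liminf_{r\to0}\frac{\log N_r(E)}{\log(1/r)}$, $\overline{\dim}_{\mathrm B}E=\limsup_{r\to0}\frac{\log N_r(E)}{\log(1/r)}$. The box dimension of $E$ exists if these two numbers coincide. *)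

theory Defs
  imports "HOL-Analysis.Analysis"
begin

text \<open>
  The circle is represented by \<open>[0,1)\<close>, so reduction modulo 1 is \<^const>\<open>frac\<close>.
  The Gauss map has domain \<open>(0,1]\<close>; values outside this interval carry no meaning.
\<close>

definition gauss_map :: "real \<Rightarrow> real" where
  "gauss_map x = frac (1 / x)"

definition invariant_under :: "('a \<Rightarrow> 'a) \<Rightarrow> 'a set \<Rightarrow> bool" where
  "invariant_under f S \<longleftrightarrow> f ` S = S"

text \<open>
  The centres of the balls range over the whole space and need not lie in \<open>E\<close>.
  The number is meaningful for bounded \<open>E\<close> and \<open>r > 0\<close>, where a finite cover exists.
\<close>

definition covering_number :: "real \<Rightarrow> 'a::euclidean_space set \<Rightarrow> nat" where
  "covering_number r E =
     (LEAST n. \<exists>C. finite C \<and> card C = n \<and> E \<subseteq> (\<Union>c\<in>C. ball c r))"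

definition lower_box_dim :: "'a::euclidean_space set \<Rightarrow> ereal" where
  "lower_box_dim E =
     Liminf (at_right 0) (\<lambda>r. ereal (ln (real (covering_number r E)) / ln (1 / r)))"

definition upper_box_dim :: "'a::euclidean_space set \<Rightarrow> ereal" where
  "upper_box_dim E =
     Limsup (at_right 0) (\<lambda>r. ereal (ln (real (covering_number r E)) / ln (1 / r)))"

end

theory Submission
  imports Defs
begin

text \<open>
  The point \<open>x\<^sub>a = [a, a, a, \<dots>]\<close>, the reciprocal of the metallic mean of \<open>a\<close>, is a fixed point
  of the Gauss map, so \<open>{x\<^sub>a | a \<in> A}\<close> is invariant for every set \<open>A\<close> of positive integers.
  As \<open>x\<^sub>a\<close> behaves like \<open>1 / a\<close>, a lacunary union of blocks \<open>A = (\<Union>k. {n\<^sub>k..<2 n\<^sub>k})\<close> with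
  \<open>n\<^sub>k = 2 ^ 16 ^ k\<close> makes the box dimension oscillate: the block of \<open>n\<^sub>k\<close> gives \<open>n\<^sub>k\<close> points with gaps at
  least of order \<open>n\<^sub>k\<^sup>-\<^sup>2\<close>, whereas at scale \<open>1 / n\<^sub>k\<^sub>+\<^sub>1\<close> all but the first \<open>2 n\<^sub>k\<close> points lie in one ball.
\<close>

section \<open>Covering numbers and box dimensions along a sequence of scales\<close>

lemma covering_number_le_card:
  assumes "finite C" "E \<subseteq> (\<Union>c\<in>C. ball c r)"
  shows "covering_number r E \<le> card C"
  unfolding covering_number_def by (rule Least_le) (use assms in blast)

text \<open>Total boundedness of the compact closure supplies some finite cover, so the
  \<open>LEAST\<close> in \<open>covering_number\<close> ranges over a non-empty set and is
  attained.\<close>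

lemma covering_number_cover:
  fixes E :: "'a::euclidean_space set"
  assumes "bounded E" "r > 0"
  obtains C where "finite C" "card C = covering_number r E" "E \<subseteq> (\<Union>c\<in>C. ball c r)"
proof -
  have "compact (closure E)"
    using assms(1) by simp
  then obtain C where "finite C" "closure E \<subseteq> (\<Union>c\<in>C. ball c r)"
    using assms(2) unfolding compact_eq_totally_bounded by blast
  then have "\<exists>n C. finite C \<and> card C = n \<and> E \<subseteq> (\<Union>c\<in>C. ball c r)"
    using closure_subset by blast
  from LeastI_ex[OF this] show thesis
    using that unfolding covering_number_def by blast
qed

text \<open>Two points of one open ball of radius \<open>r\<close> are less than
  \<open>2 * r\<close> apart, so assigning to each point of \<open>S\<close> a ball containing it is
  injective.\<close>

lemma card_separated_le_covering_number:
  fixes E :: "'a::euclidean_space set"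
  assumes "bounded E" "r > 0" "S \<subseteq> E"
    and sep: "\<And>x y. x \<in> S \<Longrightarrow> y \<in> S \<Longrightarrow> x \<noteq> y \<Longrightarrow> 2 * r \<le> dist x y"
  shows "card S \<le> covering_number r E"
proof -
  obtain C where C: "finite C" "card C = covering_number r E" "E \<subseteq> (\<Union>c\<in>C. ball c r)"
    using covering_number_cover[OF assms(1,2)] .
  have "\<forall>x\<in>S. \<exists>c. c \<in> C \<and> x \<in> ball c r"
    using C(3) assms(3) by blast
  from bchoice[OF this] obtain f where f: "\<And>x. x \<in> S \<Longrightarrow> f x \<in> C \<and> x \<in> ball (f x) r"
    by blast
  have "inj_on f S"
  proof (rule inj_onI, rule ccontr)
    fix x y assume xy: "x \<in> S" "y \<in> S" "f x = f y" "x \<noteq> y"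
    have "dist (f x) x < r" "dist (f x) y < r"
      using f[OF xy(1)] f[OF xy(2)] xy(3) by auto
    then have "dist x y < 2 * r"
      using dist_triangle3[of x y "f x"] by linarith
    then show False
      using sep[OF xy(1,2,4)] by linarith
  qed
  then show ?thesis
    using card_inj_on_le[of f S C] f C by auto
qed

text \<open>A liminf above \<open>c\<close> would force the quotient above \<open>c\<close> at all
  small scales, hence at \<open>r k\<close> for large \<open>k\<close>. One sequence of scales
  therefore suffices.\<close>

lemma lower_box_dim_le:
  assumes "filterlim r (at_right 0) sequentially"
    and "\<And>k. ln (real (covering_number (r k) E)) / ln (1 / r k) \<le> c"
  shows "lower_box_dim E \<le> ereal c"
proof (rule ccontr)
  assume "\<not> lower_box_dim E \<le> ereal c"
  then have "\<forall>\<^sub>F s in at_right 0. ereal c < ereal (ln (real (covering_number s E)) / ln (1 / s))"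
    unfolding lower_box_dim_def by (intro less_LiminfD) auto
  then have "\<forall>\<^sub>F k in sequentially. c < ln (real (covering_number (r k) E)) / ln (1 / r k)"
    using assms(1) by (auto simp: filterlim_iff)
  then obtain k where "c < ln (real (covering_number (r k) E)) / ln (1 / r k)"
    using eventually_happens'[OF sequentially_bot] by blast
  then show False
    using assms(2)[of k] by linarith
qed

lemma upper_box_dim_ge:
  assumes "filterlim r (at_right 0) sequentially"
    and "\<And>k. c \<le> ln (real (covering_number (r k) E)) / ln (1 / r k)"
  shows "ereal c \<le> upper_box_dim E"
proof (rule ccontr)
  assume "\<not> ereal c \<le> upper_box_dim E"
  then have "\<forall>\<^sub>F s in at_right 0. ereal (ln (real (covering_number s E)) / ln (1 / s)) < ereal c"
    unfolding upper_box_dim_def by (intro Limsup_lessD) auto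
  then have "\<forall>\<^sub>F k in sequentially. ln (real (covering_number (r k) E)) / ln (1 / r k) < c"
    using assms(1) by (auto simp: filterlim_iff)
  then obtain k where "ln (real (covering_number (r k) E)) / ln (1 / r k) < c"
    using eventually_happens'[OF sequentially_bot] by blast
  then show False
    using assms(2)[of k] by linarith
qed

section \<open>Fixed points of the Gauss map\<close>

definition gauss_fixpoint :: "nat \<Rightarrow> real" where
  "gauss_fixpoint a = (sqrt ((real a)\<^sup>2 + 4) - real a) / 2"

lemma gauss_fixpoint_pos: "0 < gauss_fixpoint a"
proof -
  have "sqrt ((real a)\<^sup>2) < sqrt ((real a)\<^sup>2 + 4)"
    by (intro real_sqrt_less_mono) simp
  then show ?thesis
    by (simp add: gauss_fixpoint_def)
qed

text \<open>\<open>gauss_fixpoint a\<close> is the positive root of \<open>x^2 + a * x = 1\<close>;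
  dividing by \<open>x\<close> gives the identity. The size, gap and fixed-point facts below all
  rest on it.\<close>

lemma inverse_gauss_fixpoint: "1 / gauss_fixpoint a = real a + gauss_fixpoint a"
proof -
  have "(sqrt ((real a)\<^sup>2 + 4))\<^sup>2 = (real a)\<^sup>2 + 4"
    by simp
  then have "gauss_fixpoint a * (real a + gauss_fixpoint a) = 1"
    unfolding gauss_fixpoint_def by (simp add: field_simps power2_eq_square)
  then show ?thesis
    using gauss_fixpoint_pos[of a] by (simp add: field_simps)
qed

lemma gauss_fixpoint_less:
  assumes "a \<ge> 1"
  shows "gauss_fixpoint a < 1 / real a"
proof -
  have "real a < 1 / gauss_fixpoint a"
    using inverse_gauss_fixpoint[of a] gauss_fixpoint_pos[of a] by linarith
  then show ?thesis
    using assms gauss_fixpoint_pos[of a] by (simp add: field_simps)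
qed

lemma gauss_fixpoint_less_1:
  assumes "a \<ge> 1"
  shows "gauss_fixpoint a < 1"
proof -
  have "1 / real a \<le> 1"
    using assms by simp
  then show ?thesis
    using gauss_fixpoint_less[OF assms] by linarith
qed

lemma gauss_fixpoint_ge:
  assumes "a \<ge> 1"
  shows "1 / (real a + 1) \<le> gauss_fixpoint a"
proof -
  have "1 / gauss_fixpoint a \<le> real a + 1"
    using inverse_gauss_fixpoint[of a] gauss_fixpoint_less_1[OF assms] by linarith
  then show ?thesis
    using gauss_fixpoint_pos[of a] by (simp add: field_simps)
qed

text \<open>The integer \<open>a\<close> drops out modulo 1, and the rest already lies in (0,1). The
  digit 0 must be excluded: its root is 1, which the map sends to 0.\<close>

lemma gauss_map_gauss_fixpoint:
  assumes "a \<ge> 1"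
  shows "gauss_map (gauss_fixpoint a) = gauss_fixpoint a"
proof -
  have "frac (real a + gauss_fixpoint a) = frac (gauss_fixpoint a)"
    by (simp add: frac_def)
  also have "\<dots> = gauss_fixpoint a"
    using gauss_fixpoint_pos[of a] gauss_fixpoint_less_1[OF assms] by (simp add: frac_eq)
  finally show ?thesis
    by (simp add: gauss_map_def inverse_gauss_fixpoint)
qed

text \<open>Subtracting \<open>1 / x = a + x\<close> from \<open>1 / y = b + y\<close> and clearing
  denominators gives \<open>(x - y) * (1 + x * y) = (b - a) * (x * y)\<close>. Here
  \<open>b - a\<close> is at least 1, \<open>1 + x * y\<close> is at most 2, and both roots are at
  least \<open>1 / N\<close>.\<close>

lemma gauss_fixpoint_diff_ge:
  assumes "1 \<le> a" "a < b" "b < N"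
  shows "1 / (2 * (real N)\<^sup>2) \<le> gauss_fixpoint a - gauss_fixpoint b"
proof -
  define x y where "x = gauss_fixpoint a" and "y = gauss_fixpoint b"
  have pos: "0 < x" "0 < y"
    using gauss_fixpoint_pos by (auto simp: x_def y_def)
  have ge: "1 / real N \<le> x" "1 / real N \<le> y"
    using gauss_fixpoint_ge[of a] gauss_fixpoint_ge[of b] assms
      frac_le[of 1 1 "real a + 1" "real N"] frac_le[of 1 1 "real b + 1" "real N"]
    unfolding x_def y_def by (simp_all)
  have lt: "x < 1" "y < 1"
    using gauss_fixpoint_less_1[of a] gauss_fixpoint_less_1[of b] assms by (auto simp: x_def y_def)
  have "1 / y - 1 / x = real b - real a + (y - x)"
    using inverse_gauss_fixpoint[of a] inverse_gauss_fixpoint[of b] by (simp add: x_def y_def)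
  then have eq: "(x - y) * (1 + x * y) = (real b - real a) * (x * y)"
    using pos by (simp add: field_simps)
  have "x * y \<le> (real b - real a) * (x * y)"
    using assms pos mult_right_mono[of 1 "real b - real a" "x * y"] by simp
  then have *: "x * y \<le> (x - y) * (1 + x * y)"
    using eq by simp
  have "0 < x * y" "x * y \<le> 1"
    using pos lt mult_le_one[of x y] by auto
  \<comment> \<open>The sign is settled first, since replacing the factor \<open>1 + x * y\<close>
    by 2 enlarges the product only if \<open>x - y\<close> is nonnegative.\<close>
  have "0 \<le> x - y"
    by (rule ccontr) (use * \<open>0 < x * y\<close> mult_neg_pos[of "x - y" "1 + x * y"] in linarith)
  then have "(x - y) * (1 + x * y) \<le> (x - y) * 2"
    using \<open>x * y \<le> 1\<close> by (intro mult_left_mono) auto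
  with * have "x * y \<le> (x - y) * 2"
    by (rule order_trans)
  then have "x * y / 2 \<le> x - y"
    by simp
  moreover have "1 / real N * (1 / real N) \<le> x * y"
    using ge pos by (intro mult_mono) auto
  ultimately show ?thesis
    by (simp add: x_def y_def power2_eq_square)
qed

section \<open>The lacunary set of digits\<close>

definition block_start :: "nat \<Rightarrow> nat" where
  "block_start k = 2 ^ 16 ^ k"

definition lacunary_digits :: "nat set" where
  "lacunary_digits = (\<Union>k. {block_start k..<2 * block_start k})"

lemma block_start_gt: "k < block_start k"
proof -
  have "k \<le> 2 ^ k"
    by (simp add: less_imp_le)
  also have "(2::nat) ^ k \<le> 16 ^ k"
    by (rule power_mono) auto
  also have "(16::nat) ^ k < 2 ^ 16 ^ k"
    by (rule less_exp)
  finally show ?thesis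
    by (simp add: block_start_def)
qed

lemma block_start_mono: "i \<le> j \<Longrightarrow> block_start i \<le> block_start j"
  by (simp add: block_start_def power_increasing)

lemma lacunary_digits_ge_1: "a \<in> lacunary_digits \<Longrightarrow> 1 \<le> a"
  using block_start_gt by (fastforce simp: lacunary_digits_def)

text \<open>The block containing \<open>a\<close> starts before \<open>block_start (Suc k)\<close>,
  so its index is at most \<open>k\<close>, and every such block ends by
  \<open>2 * block_start k\<close>.\<close>

lemma lacunary_digits_gap:
  assumes "a \<in> lacunary_digits" "a < block_start (Suc k)"
  shows "a < 2 * block_start k"
proof -
  obtain j where j: "block_start j \<le> a" "a < 2 * block_start j"
    using assms(1) by (auto simp: lacunary_digits_def)
  have "j \<le> k"
    using j(1) assms(2) block_start_mono[of "Suc k" j] by (cases "j \<le> k") auto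
  then show ?thesis
    using block_start_mono[of j k] j(2) by linarith
qed

lemma ln_block_start: "ln (real (block_start k)) = 16 ^ k * ln 2"
  by (simp add: block_start_def ln_realpow)

lemma filterlim_block_start: "filterlim (\<lambda>k. real (block_start k)) at_top sequentially"
proof (rule filterlim_at_top_mono[OF filterlim_real_sequentially])
  show "\<forall>\<^sub>F k in sequentially. real k \<le> real (block_start k)"
    using block_start_gt by (intro always_eventually allI) (simp add: less_imp_le)
qed

section \<open>The two dimension estimates\<close>

lemma lower_box_dim_gauss_fixpoint_lacunary:
  "lower_box_dim (gauss_fixpoint ` lacunary_digits) \<le> ereal (1 / 4)"
proof (rule lower_box_dim_le)
  show "filterlim (\<lambda>k. 1 / real (block_start (Suc k))) (at_right 0) sequentially"
    using filterlim_compose[OF filterlim_inverse_at_right_top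
        filterlim_compose[OF filterlim_block_start filterlim_Suc]]
    by (simp add: inverse_eq_divide)
next
  fix k
  define n N where "n = block_start k" and "N = block_start (Suc k)"
  define E where "E = gauss_fixpoint ` lacunary_digits"
  \<comment> \<open>The ball around 0 catches every point with digit at least \<open>N\<close>, as
    these are below \<open>1 / N\<close>. By the gap, all other digits are below
    \<open>2 * n\<close>, and each of their points gets its own ball.\<close>
  define C where "C = insert 0 (gauss_fixpoint ` {..<2 * n})"
  have N1: "1 \<le> N" and n1: "1 \<le> n"
    by (auto simp: N_def n_def block_start_def)
  have "E \<subseteq> (\<Union>c\<in>C. ball c (1 / real N))"
  proof
    fix x assume "x \<in> E"
    then obtain a where a: "a \<in> lacunary_digits" "x = gauss_fixpoint a"
      by (auto simp: E_def)
    show "x \<in> (\<Union>c\<in>C. ball c (1 / real N))"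
    proof (cases "a < N")
      case True
      then have "x \<in> C"
        using lacunary_digits_gap[of a k] a by (auto simp: C_def n_def N_def)
      then show ?thesis
        using N1 by (auto intro!: bexI[of _ x])
    next
      case False
      have "x < 1 / real a"
        using gauss_fixpoint_less[of a] lacunary_digits_ge_1 a by simp
      also have "\<dots> \<le> 1 / real N"
        using False N1 by (intro frac_le) auto
      finally show ?thesis
        using gauss_fixpoint_pos[of a] a by (auto simp: C_def)
    qed
  qed
  then have "covering_number (1 / real N) E \<le> card C"
    by (intro covering_number_le_card) (auto simp: C_def)
  also have "\<dots> \<le> Suc (card (gauss_fixpoint ` {..<2 * n}))"
    unfolding C_def by (rule card_insert_le_m1) auto
  \<comment> \<open>The count \<open>2 * n + 1\<close> is rounded up to a power of two, so that its
    logarithm is a multiple of \<open>ln 2\<close>.\<close>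
  also have "\<dots> \<le> 4 * n"
    using card_image_le[of "{..<2 * n}" gauss_fixpoint] n1 by simp
  finally have "covering_number (1 / real N) E \<le> 4 * n" .
  \<comment> \<open>A covering number of 0 is not ruled out here; the convention
    \<open>ln 0 = 0\<close> settles that case.\<close>
  then have "ln (real (covering_number (1 / real N) E)) \<le> ln (4 * real n)"
    using n1 by (cases "covering_number (1 / real N) E = 0") (auto simp: ln_ge_zero)
  also have "\<dots> = (2 + 16 ^ k) * ln 2"
    using n1 ln_realpow[of 2 2]
    by (simp add: ln_mult n_def ln_block_start distrib_right)
  \<comment> \<open>Passing to the next block multiplies the logarithm by 16, so the target
    \<open>ln N / 4\<close> is \<open>4 * 16 ^ k * ln 2\<close>. The quotient
    \<open>(2 + 16 ^ k) / 16 ^ Suc k\<close> tends to 1/16; the slack up to 1/4 absorbs the 2 for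
    every \<open>k\<close>, including 0.\<close>
  also have "\<dots> \<le> (4 * 16 ^ k) * ln 2"
  proof (rule mult_right_mono)
    have "1 \<le> (16::real) ^ k"
      by (rule one_le_power) simp
    then show "2 + (16::real) ^ k \<le> 4 * 16 ^ k"
      by linarith
  qed simp
  also have "\<dots> = 1 / 4 * ln (real N)"
    by (simp add: N_def ln_block_start)
  finally have "ln (real (covering_number (1 / real N) E)) \<le> 1 / 4 * ln (real N)" .
  moreover have "0 < ln (real N)"
    by (simp add: N_def ln_block_start)
  ultimately show "ln (real (covering_number (1 / real (block_start (Suc k)))
      (gauss_fixpoint ` lacunary_digits))) / ln (1 / (1 / real (block_start (Suc k)))) \<le> 1 / 4"
    unfolding E_def N_def by (simp add: field_simps)
qed

lemma upper_box_dim_gauss_fixpoint_lacunary: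
  "ereal (1 / 3) \<le> upper_box_dim (gauss_fixpoint ` lacunary_digits)"
proof (rule upper_box_dim_ge)
  have "filterlim (\<lambda>k. 16 * (real (block_start (Suc k)))\<^sup>2) at_top sequentially"
    by (intro filterlim_tendsto_pos_mult_at_top[OF tendsto_const] filterlim_pow_at_top
        filterlim_compose[OF filterlim_block_start filterlim_Suc]) auto
  from filterlim_compose[OF filterlim_inverse_at_right_top this]
  show "filterlim (\<lambda>k. 1 / (16 * (real (block_start (Suc k)))\<^sup>2)) (at_right 0) sequentially"
    by (simp add: inverse_eq_divide)
next
  fix k
  define n where "n = block_start (Suc k)"
  \<comment> \<open>Digits of the block are below \<open>2 * n\<close>, so the gap bound is
    \<open>1 / (2 * (2 * n)^2) = 1 / (8 * n^2)\<close>, which is exactly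
    \<open>2 * r\<close>.\<close>
  define r where "r = 1 / (16 * (real n)\<^sup>2)"
  define E where "E = gauss_fixpoint ` lacunary_digits"
  define S where "S = gauss_fixpoint ` {n..<2 * n}"
  have n1: "1 \<le> n"
    by (auto simp: n_def block_start_def)
  have r: "0 < r"
    using n1 by (simp add: r_def)
  have sep: "2 * r \<le> \<bar>gauss_fixpoint a - gauss_fixpoint b\<bar>"
    if "a \<in> {n..<2 * n}" "b \<in> {n..<2 * n}" "a < b" for a b
    using gauss_fixpoint_diff_ge[of a b "2 * n"] that n1 by (simp add: r_def power2_eq_square)
  have sep': "2 * r \<le> dist (gauss_fixpoint a) (gauss_fixpoint b)"
    if "a \<in> {n..<2 * n}" "b \<in> {n..<2 * n}" "a \<noteq> b" for a b
    using sep[of a b] sep[of b a] that by (cases a b rule: linorder_cases) (auto simp: dist_real_def)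
  have "inj_on gauss_fixpoint {n..<2 * n}"
    using sep' r by (intro inj_onI, metis dist_self mult_pos_pos not_le zero_less_numeral)
  then have "card S = n"
    by (simp add: S_def card_image)
  moreover have "card S \<le> covering_number r E"
  proof (rule card_separated_le_covering_number)
    have "E \<subseteq> {0..1}"
      using gauss_fixpoint_pos gauss_fixpoint_less_1 lacunary_digits_ge_1
      by (auto simp: E_def less_imp_le)
    then show "bounded E"
      using bounded_closed_interval bounded_subset by blast
    show "S \<subseteq> E"
      unfolding S_def E_def lacunary_digits_def n_def by blast
    show "2 * r \<le> dist x y" if "x \<in> S" "y \<in> S" "x \<noteq> y" for x y
      using that sep' unfolding S_def by blast
  qed (fact r)
  ultimately have le: "ln (real n) \<le> ln (real (covering_number r E))"
    using n1 by simp
  define m :: real where "m = 16 ^ Suc k"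
  have "1 \<le> (16::real) ^ k"
    by (rule one_le_power) simp
  then have m: "4 \<le> m"
    unfolding m_def power_Suc by linarith
  have lnn: "ln (real n) = m * ln 2"
    unfolding n_def m_def by (rule ln_block_start)
  have "ln (1 / r) = ln (2 ^ 4 * real n ^ 2)"
    by (simp add: r_def)
  also have "\<dots> = ln (2 ^ 4) + ln (real n ^ 2)"
    using n1 by (intro ln_mult_pos) auto
  also have "\<dots> = (4 + 2 * m) * ln 2"
    using n1 ln_realpow[of 2 4] ln_realpow[of "real n" 2] by (simp add: lnn distrib_right)
  finally have lnr: "ln (1 / r) = (4 + 2 * m) * ln 2" .
  \<comment> \<open>The quotient \<open>m / (4 + 2 * m)\<close> tends to 1/2 and reaches 1/3 once
    \<open>m\<close> is at least 4. This is why the scales start at block 1: block 0 has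
    \<open>m = 1\<close> and would yield only 1/6.\<close>
  have "(4 + 2 * m) * ln 2 \<le> (3 * m) * ln 2"
    using m by (intro mult_right_mono) auto
  then have "1 / 3 * ln (1 / r) \<le> ln (real (covering_number r E))"
    using le lnn lnr by linarith
  moreover have "0 < ln (1 / r)"
    using m unfolding lnr by simp
  ultimately have "1 / 3 \<le> ln (real (covering_number r E)) / ln (1 / r)"
    by (simp only: pos_le_divide_eq)
  then show "1 / 3 \<le> ln (real (covering_number (1 / (16 * (real (block_start (Suc k)))\<^sup>2))
      (gauss_fixpoint ` lacunary_digits))) / ln (1 / (1 / (16 * (real (block_start (Suc k)))\<^sup>2)))"
    unfolding r_def E_def n_def .
qed

theorem theoremA:
  shows "\<exists>\<Lambda> :: real set.
           \<Lambda> \<noteq> {} \<and> \<Lambda> \<in> sets borel \<and> \<Lambda> \<subseteq> {0<..<1} \<and>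
           invariant_under gauss_map \<Lambda> \<and>
           lower_box_dim \<Lambda> < upper_box_dim \<Lambda>"
proof (intro exI conjI)
  let ?L = "gauss_fixpoint ` lacunary_digits"
  have "block_start 0 \<in> lacunary_digits"
    unfolding lacunary_digits_def by (rule UN_I[of 0]) (simp_all add: block_start_def)
  then show "?L \<noteq> {}"
    by blast
  \<comment> \<open>The set is the image of a set of naturals, hence a countable union of Borel
    singletons.\<close>
  show "?L \<in> sets borel"
    by (rule sets.countable) simp_all
  show "?L \<subseteq> {0<..<1}"
    using gauss_fixpoint_pos gauss_fixpoint_less_1 lacunary_digits_ge_1 by auto
  \<comment> \<open>The map fixes the set pointwise, so both inclusions hold at once.\<close>
  show "invariant_under gauss_map ?L"
    unfolding invariant_under_def image_image
    by (rule image_cong[OF refl]) (rule gauss_map_gauss_fixpoint[OF lacunary_digits_ge_1])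
  have "lower_box_dim ?L \<le> ereal (1 / 4)"
    by (rule lower_box_dim_gauss_fixpoint_lacunary)
  also have "\<dots> < ereal (1 / 3)"
    by simp
  also have "\<dots> \<le> upper_box_dim ?L"
    by (rule upper_box_dim_gauss_fixpoint_lacunary)
  finally show "lower_box_dim ?L < upper_box_dim ?L" .
qed

end
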